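(* Let $X\subset\mathbb{R}^d$ be an indexed dataset, let $v=(0,\ldots,0,1)\in\mathbb{R}^{d+1}$, and let $s>0$. If $s\ge\max_{x\in X}\|x\|$, then $S(X,v,s)$ lies on the closed hemisphere in direction $v$, i.e., $\langle\hat{x},v\rangle\ge 0$ for all $\hat{x}\in S(X,v,s)$. If $s>\max_{x\in X}\|x\|$, then all embedded vectors lie on the open hemisphere in direction $v$, i.e., $\langle\hat{x},v\rangle>0$ for all $\hat{x}\in S(X,v,s)$.
   Context: $\|\cdot\|$ is the Euclidean norm and $\langle\cdot,\cdot\rangle$ the standard inner product. A dataset is a nonempty finite indexed set of vectors. For $v=(0,\ldots,0,1)\in\mathbb{R}^{d+1}$ and $s>0$, the spherical embedding of a point $x\in\mathbb{R}^d$ is $$S(x,v,s)=2s\,\frac{[x,s]}{\|x\|^2+s^2}-v,$$ where $[x,s]\in\mathbb{R}^{d+1}$ is $x$ extended by the last coordinate $s$; it is a point of the unit sphere of $\mathbb{R}^{d+1}$. For a set $X$, $S(X,v,s)=\{S(x,v,s):x\in X\}$. *)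

theory Defs
  imports "HOL-Analysis.Analysis"
begin

text \<open>
  The space of dimension \<open>d + 1\<close> is \<open>real ^ ('n + 1)\<close>, where \<open>'n\<close> has \<open>d\<close> elements and
  \<open>'n + 1\<close> is the sum type with the one-element type: \<open>Inl i\<close> indexes the first \<open>d\<close>
  coordinates and \<open>Inr 1\<close> the last one.
\<close>

definition extend :: "real ^ 'n \<Rightarrow> real \<Rightarrow> real ^ ('n::finite + 1)" where
  "extend x a = (\<chi> j. case j of Inl i \<Rightarrow> x $ i | Inr _ \<Rightarrow> a)"

definition spherical_embedding ::
    "real ^ 'n \<Rightarrow> real ^ ('n::finite + 1) \<Rightarrow> real \<Rightarrow> real ^ ('n + 1)" where
  "spherical_embedding x v s = (2 * s / ((norm x)\<^sup>2 + s\<^sup>2)) *\<^sub>R extend x s - v"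

definition spherical_embedding_set ::
    "(real ^ 'n) set \<Rightarrow> real ^ ('n::finite + 1) \<Rightarrow> real \<Rightarrow> (real ^ ('n + 1)) set" where
  "spherical_embedding_set X v s = {spherical_embedding x v s | x. x \<in> X}"

definition closed_hemisphere :: "'a::real_inner \<Rightarrow> 'a set" where
  "closed_hemisphere v = {y \<in> sphere 0 1. inner y v \<ge> 0}"

definition open_hemisphere :: "'a::real_inner \<Rightarrow> 'a set" where
  "open_hemisphere v = {y \<in> sphere 0 1. inner y v > 0}"

end

theory Submission
  imports Defs
begin

text \<open>The vector v is \<open>extend 0 1\<close>, so pairing with v reads off the last
  coordinate. For an embedded point it is 2s^2/(|x|^2 + s^2) - 1 = (s^2 - |x|^2)/(s^2 + |x|^2),
  which has the sign of s - |x| (\<open>inner_spherical_embedding\<close>). As the hemispheres are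
  subsets of the unit sphere, embedded points must also have norm 1
  (\<open>norm_spherical_embedding\<close>).\<close>

lemma inner_extend: "inner (extend x a) (extend y b) = inner x y + a * b"
proof -
  have one: "(UNIV :: 1 set) = {1}" by auto
  show ?thesis
    \<comment> \<open>The index type is split into its \<open>Inl\<close> part, which contributes
      \<open>inner x y\<close>, and its single \<open>Inr\<close> index, which contributes
      \<open>a * b\<close>.\<close>
    unfolding inner_vec_def extend_def UNIV_Plus_UNIV[symmetric]
    by (subst sum.Plus) (auto simp: one)
qed

lemma norm_extend_squared: "(norm (extend x a))\<^sup>2 = (norm x)\<^sup>2 + a\<^sup>2"
  by (simp only: power2_norm_eq_inner inner_extend) (simp add: power2_eq_square)

context
  fixes x :: "real ^ 'n::finite" and s :: real
  assumes s: "s > 0"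
begin

text \<open>With w = [x,s], we have <v,w> = s and |w|^2 = |x|^2 + s^2, so the embedding is 2
  (<v,w>/|w|^2) w - v: the reflection of the unit vector v across the line through w.\<close>

lemma norm_spherical_embedding: "norm (spherical_embedding x (extend 0 1) s) = 1"
proof -
  define q where "q = (norm x)\<^sup>2 + s\<^sup>2"
  define c where "c = 2 * s / q"
  have "q > 0" using s by (simp add: q_def add_nonneg_pos)
  then have cq: "c * q = 2 * s" by (simp add: c_def)
  have "inner (extend x s) (extend x s) = q"
    by (simp add: q_def norm_extend_squared flip: power2_norm_eq_inner)
  \<comment> \<open>The square is expanded with one factor \<open>c * q\<close> kept intact:
    replacing it by \<open>2 * s\<close> cancels the cross term.\<close>
  then have "(norm (c *\<^sub>R extend x s - extend 0 1))\<^sup>2 = c * (c * q) - 2 * c * s + 1"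
    by (simp add: power2_norm_eq_inner inner_diff_left inner_diff_right inner_commute
        inner_extend algebra_simps)
  also have "\<dots> = 1" by (simp add: cq)
  finally have "norm (c *\<^sub>R extend x s - extend 0 1) = 1"
    by (metis norm_ge_zero one_power2 power2_eq_iff_nonneg zero_le_one)
  then show ?thesis
    by (simp add: spherical_embedding_def c_def q_def)
qed

lemma inner_spherical_embedding:
  "inner (spherical_embedding x (extend 0 1) s) (extend 0 1)
    = (s\<^sup>2 - (norm x)\<^sup>2) / (s\<^sup>2 + (norm x)\<^sup>2)"
proof -
  have "2 * s / ((norm x)\<^sup>2 + s\<^sup>2) * s - 1
      = (s\<^sup>2 - (norm x)\<^sup>2) / (s\<^sup>2 + (norm x)\<^sup>2)"
    using s by (simp add: divide_simps) (simp add: power2_eq_square algebra_simps)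
  then show ?thesis
    by (simp add: spherical_embedding_def inner_diff_left inner_extend)
qed

lemma spherical_embedding_in_closed_hemisphere:
  assumes "norm x \<le> s"
  shows "spherical_embedding x (extend 0 1) s \<in> closed_hemisphere (extend 0 1)"
  using power_mono[OF assms, of 2]
  by (simp add: closed_hemisphere_def norm_spherical_embedding inner_spherical_embedding)

lemma spherical_embedding_in_open_hemisphere:
  assumes "norm x < s"
  shows "spherical_embedding x (extend 0 1) s \<in> open_hemisphere (extend 0 1)"
proof -
  have "(norm x)\<^sup>2 < s\<^sup>2" using assms by (simp add: power_strict_mono)
  \<comment> \<open>A positive numerator gives a positive quotient only over a positive denominator;
    here \<open>s > 0\<close> ensures it even at x = 0.\<close>
  moreover have "s\<^sup>2 + (norm x)\<^sup>2 > 0" using s by (simp add: add_pos_nonneg)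
  ultimately show ?thesis
    by (simp add: open_hemisphere_def norm_spherical_embedding inner_spherical_embedding)
qed

end

theorem corollary3:
  fixes I :: "'i set" and x :: "'i \<Rightarrow> real ^ 'n::finite"
    and X :: "(real ^ 'n) set" and v :: "real ^ ('n + 1)" and s :: real
  assumes "finite I" and "I \<noteq> {}" and "X = x ` I"
    and "v = extend 0 1"
    and "s > 0"
  shows "(s \<ge> (MAX y\<in>X. norm y) \<longrightarrow> spherical_embedding_set X v s \<subseteq> closed_hemisphere v)
       \<and> (s > (MAX y\<in>X. norm y) \<longrightarrow> spherical_embedding_set X v s \<subseteq> open_hemisphere v)"
proof -
  \<comment> \<open>This turns either bound on the maximum into the pointwise bound that the
    hemisphere lemmas take.\<close>
  have le: "norm y \<le> (MAX y\<in>X. norm y)" if "y \<in> X" for y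
    using assms(1,3) that by (intro Max_ge) auto
  show ?thesis
    unfolding spherical_embedding_set_def assms(4)
    using le assms(5)
    by (blast intro: spherical_embedding_in_closed_hemisphere
        spherical_embedding_in_open_hemisphere order_trans le_less_trans)
qed

end
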